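(* For every integer $n\geq 1$, the polynomial $S_{2n}(q)$ is divisible by $P_n(q)$. In particular, $S_{2n}(q)$ is divisible by $(1+q^{2r+1})^{\left\lfloor \frac{n}{2r+1}\right\rfloor}$ for any integer $r\geq 0$.
   Context: For $n\ge 1$ let $(a;q)_n=(1-a)(1-aq)\cdots(1-aq^{n-1})$, and $(a;q)_0=1$. The $q$-Sali\'e numbers $S_{2n}(q)$ are defined by the formal power series identity $$\sum_{n=0}^{\infty}S_{2n}(q)\frac{x^{2n}}{(q;q)_{2n}}=\left(\sum_{n=0}^{\infty}\frac{q^nx^{2n}}{(q;q)_{2n}}\right)\left(\sum_{n=0}^{\infty}(-1)^n\frac{x^{2n}}{(q;q)_{2n}}\right)^{-1}.$$ They are polynomials in $q$ with integer coefficients. For each positive integer $n$, write $n=2^s(2r+1)$ with $r,s\geq 0$ and set $p_n(q)=1+q^{2r+1}$. Define $$P_n(q)=\prod_{k=1}^{n}p_k(q)=\prod_{r\geq 0}(1+q^{2r+1})^{a_{n,r}},$$ where $a_{n,r}$ is the number of positive integers of the form $2^s(2r+1)$ ($s\ge 0$) that are less than or equal to $n$. Divisibility is in $\mathbb{Z}[q]$. *)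

theory Defs
  imports "HOL-Computational_Algebra.Computational_Algebra"
begin

definition qpoch :: "'a::comm_ring_1 \<Rightarrow> 'a \<Rightarrow> nat \<Rightarrow> 'a" where
  "qpoch a q n = (\<Prod>i<n. 1 - a * q ^ i)"

(* The generating functions have coefficients in the field of fractions of Z[q]. *)
definition qf :: "int poly fract" where
  "qf = to_fract (monom 1 1)"

(* The formal power series in x given by the sum over n of c n * x^(2n) / (q;q)_(2n). *)
definition even_qseries :: "(nat \<Rightarrow> int poly fract) \<Rightarrow> int poly fract fps" where
  "even_qseries c = Abs_fps (\<lambda>m. if even m then c (m div 2) / qpoch qf qf m else 0)"

(* Only even indices matter: "q_Salie (2 * n)" is S_(2n)(q), and the odd-indexed values are 0.
   That these numbers satisfy the defining identity, and are the only ones that do, is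
   q_Salie_gf and q_Salie_unique below. *)
definition q_Salie :: "nat \<Rightarrow> int poly fract" where
  "q_Salie m = qpoch qf qf m *
     fps_nth (even_qseries (\<lambda>n. qf ^ n) * inverse (even_qseries (\<lambda>n. (-1) ^ n))) m"

lemma qpoch_qf_nonzero: "qpoch qf qf n \<noteq> 0"
proof -
  have "1 - qf * qf ^ i \<noteq> 0" for i
  proof
    assume "1 - qf * qf ^ i = 0"
    hence "qf ^ Suc i = to_fract 1"
      by simp
    moreover have "qf ^ k = to_fract (monom 1 1 ^ k)" for k
      unfolding qf_def by (induction k) simp_all
    ultimately have "to_fract (monom 1 1 ^ Suc i :: int poly) = to_fract 1"
      by metis
    hence "to_fract (monom 1 (Suc i) :: int poly) = to_fract 1"
      by (simp only: monom_power power_one) simp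
    hence "monom 1 (Suc i) = (1 :: int poly)"
      by (simp only: to_fract_eq_iff)
    hence "degree (monom 1 (Suc i) :: int poly) = 0"
      by simp
    thus False by (simp add: degree_monom_eq)
  qed
  thus ?thesis by (simp add: qpoch_def)
qed

lemma even_qseries_nth:
  "fps_nth (even_qseries c) m = (if even m then c (m div 2) / qpoch qf qf m else 0)"
  by (simp add: even_qseries_def)

lemma even_qseries_compose:
  "even_qseries c = Abs_fps (\<lambda>n. c n / qpoch qf qf (2 * n)) oo fps_X ^ 2"
  by (rule fps_ext) (auto simp: even_qseries_def fps_nth_compose_X_power elim!: evenE)

lemma q_Salie_gf:
  "even_qseries (\<lambda>n. q_Salie (2 * n)) =
     even_qseries (\<lambda>n. qf ^ n) * inverse (even_qseries (\<lambda>n. (-1) ^ n))"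
  (is "_ = ?F * inverse ?G")
proof -
  define A where "A = Abs_fps (\<lambda>n. qf ^ n / qpoch qf qf (2 * n))"
  define B where "B = Abs_fps (\<lambda>n. (-1) ^ n / qpoch qf qf (2 * n))"
  have B0: "fps_nth B 0 \<noteq> 0"
    by (simp add: B_def qpoch_def)
  have X0: "fps_nth (fps_X ^ 2 :: int poly fract fps) 0 = 0"
    by simp
  have "?F * inverse ?G = (A * inverse B) oo fps_X ^ 2"
    using fps_inverse_compose[OF X0 B0] fps_compose_mult_distrib[OF X0, of A "inverse B"]
    unfolding even_qseries_compose A_def[symmetric] B_def[symmetric] by simp
  hence "fps_nth (?F * inverse ?G) m = 0" if "odd m" for m
    using that by (simp add: fps_nth_compose_X_power)
  thus ?thesis
    by (intro fps_ext) (simp add: even_qseries_nth q_Salie_def qpoch_qf_nonzero)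
qed

lemma q_Salie_unique:
  assumes "even_qseries S = even_qseries (\<lambda>n. qf ^ n) * inverse (even_qseries (\<lambda>n. (-1) ^ n))"
  shows "S n = q_Salie (2 * n)"
proof -
  have "fps_nth (even_qseries S) (2 * n) = fps_nth (even_qseries (\<lambda>n. q_Salie (2 * n))) (2 * n)"
    using assms q_Salie_gf by simp
  thus ?thesis
    by (simp add: even_qseries_def qpoch_qf_nonzero)
qed

(* For k = 2^s * (2r+1), the exponent is the odd part 2r+1 of k; see p_factor_eq. *)
definition p_factor :: "nat \<Rightarrow> int poly" where
  "p_factor k = 1 + monom 1 (k div 2 ^ multiplicity 2 k)"

definition P_poly :: "nat \<Rightarrow> int poly" where
  "P_poly n = (\<Prod>k=1..n. p_factor k)"

lemma multiplicity_two_odd: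
  "multiplicity 2 (2 ^ s * (2 * r + 1) :: nat) = s"
proof -
  have "multiplicity 2 (2 * r + 1) = 0"
    by (rule not_dvd_imp_multiplicity_0) simp
  thus ?thesis
    by (subst prime_elem_multiplicity_mult_distrib) auto
qed

lemma p_factor_eq:
  "p_factor (2 ^ s * (2 * r + 1)) = 1 + monom 1 (2 * r + 1)"
  unfolding p_factor_def multiplicity_two_odd by simp

(* Every r > n contributes exponent 0, so the product over all r is the one over r \<le> n. *)
lemma P_poly_eq:
  "P_poly n = (\<Prod>r\<le>n. (1 + monom 1 (2 * r + 1)) ^ card {k \<in> {1..n}. \<exists>s. k = 2 ^ s * (2 * r + 1)})"
proof -
  define g :: "nat \<Rightarrow> nat" where "g k = (k div 2 ^ multiplicity 2 k) div 2" for k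
  have g: "g (2 ^ s * (2 * r + 1)) = r" for s r
    unfolding g_def multiplicity_two_odd by simp
  have dec: "\<exists>s. k = 2 ^ s * (2 * g k + 1)" if "k \<in> {1..n}" for k
  proof -
    have "k \<noteq> 0" "\<not> is_unit (2 :: nat)" using that by auto
    then obtain y where "k = 2 ^ multiplicity 2 k * y" "odd y"
      by (rule multiplicity_decompose')
    then obtain r where "k = 2 ^ multiplicity 2 k * (2 * r + 1)"
      by (metis oddE)
    thus ?thesis by (metis g)
  qed
  have eq: "{k \<in> {1..n}. \<exists>s. k = 2 ^ s * (2 * r + 1)} = {k \<in> {1..n}. g k = r}" for r
    using dec g by blast
  have "g ` {1..n} \<subseteq> {..n}"
  proof
    fix r assume "r \<in> g ` {1..n}"
    then obtain k where "k \<in> {1..n}" "r = g k" by auto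
    moreover have "g k \<le> k"
      unfolding g_def by (meson div_le_dividend order_trans)
    ultimately show "r \<in> {..n}" by simp
  qed
  hence "P_poly n = (\<Prod>r\<le>n. \<Prod>k\<in>{k \<in> {1..n}. g k = r}. p_factor k)"
    unfolding P_poly_def by (intro prod.group[symmetric]) auto
  also have "\<dots> = (\<Prod>r\<le>n. (1 + monom 1 (2 * r + 1)) ^ card {k \<in> {1..n}. g k = r})"
  proof (intro prod.cong refl)
    fix r
    have "p_factor k = 1 + monom 1 (2 * r + 1)" if "k \<in> {k \<in> {1..n}. g k = r}" for k
      using that dec[of k] p_factor_eq by auto
    thus "(\<Prod>k\<in>{k \<in> {1..n}. g k = r}. p_factor k) =
        (1 + monom 1 (2 * r + 1)) ^ card {k \<in> {1..n}. g k = r}"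
      by simp
  qed
  finally show ?thesis by (simp only: eq)
qed

end

(*
  As 1 + q^k divides 1 - q^(2kj) for all j, the product P_n(q) divides (q;q)_{2n}. It therefore
  suffices that the coefficient S_{2n}(q) / (q;q)_{2n} of the quotient F/G of the two generating
  functions has no prime p of Z[q] with p | 1 + q^k, k odd, in its denominator. Modulo such a p
  the element q has order N = 2d with d odd and q^d = -1. The series e(x) = sum x^m / (q;q)_m
  satisfies e(q^N x) = (x;q)_N e(x) and (x;q)_N = 1 - x^N modulo p. If H solves H(x) = (1 + s
  x^N) H(q^N x) with s = -1 modulo p, then u = e H satisfies (1 + s x^N) (u(q^N x) - u(x)) = p
  (...) u(x), and since p divides q^(Nm) - 1 only once, all coefficients of u are p-integral.
  With t = q and t = -1 (where t^d = -1 modulo p because d is odd) this shows that F and G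
  become p-integral after multiplication by one and the same series, the solution H for s = 1:
  the substitution of t^(1/2) x for x turns s = t^(-d) into s = 1. Hence F/G = (F H)/(G H) is
  p-integral.
*)

theory Submission
  imports Defs
begin

section \<open>Dilations f(c x) of power series\<close>

lemma qpoch_0 [simp]: "qpoch a q 0 = 1"
  by (simp add: qpoch_def)

lemma qpoch_Suc: "qpoch a q (Suc n) = qpoch a q n * (1 - a * q ^ n)"
  by (simp add: qpoch_def)

definition fps_scale :: "'a::comm_ring_1 \<Rightarrow> 'a fps \<Rightarrow> 'a fps" where
  "fps_scale c f = Abs_fps (\<lambda>n. c ^ n * fps_nth f n)"

lemma fps_scale_nth [simp]: "fps_nth (fps_scale c f) n = c ^ n * fps_nth f n"
  by (simp add: fps_scale_def)

lemma fps_scale_mult: "fps_scale c (f * g) = fps_scale c f * fps_scale c g"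
proof (rule fps_ext)
  fix n
  have "c ^ n * (fps_nth f i * fps_nth g (n - i)) =
      (c ^ i * fps_nth f i) * (c ^ (n - i) * fps_nth g (n - i))" if "i \<le> n" for i
    using that power_add[of c i "n - i"] by (simp add: ac_simps)
  thus "fps_nth (fps_scale c (f * g)) n = fps_nth (fps_scale c f * fps_scale c g) n"
    by (simp add: fps_mult_nth sum_distrib_left)
qed

lemma fps_scale_scale: "fps_scale a (fps_scale b f) = fps_scale (a * b) f"
  by (rule fps_ext) (simp add: power_mult_distrib mult.assoc)

section \<open>The q-exponential e(x) and the finite products (x;q)_n\<close>

definition q_exp :: "'a::field \<Rightarrow> 'a fps" where
  "q_exp q = Abs_fps (\<lambda>n. 1 / qpoch q q n)"

definition q_fact_fps :: "'a::comm_ring_1 \<Rightarrow> nat \<Rightarrow> 'a fps" where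
  "q_fact_fps q n = (\<Prod>i<n. 1 - fps_const (q ^ i) * fps_X)"

lemma q_fact_fps_Suc_nth:
  "fps_nth (q_fact_fps q (Suc n)) (Suc k) =
     fps_nth (q_fact_fps q n) (Suc k) - q ^ n * fps_nth (q_fact_fps q n) k"
  "fps_nth (q_fact_fps q (Suc n)) 0 = fps_nth (q_fact_fps q n) 0"
proof -
  have "q_fact_fps q (Suc n) = q_fact_fps q n - fps_const (q ^ n) * (q_fact_fps q n * fps_X)"
    by (simp add: q_fact_fps_def algebra_simps)
  thus "fps_nth (q_fact_fps q (Suc n)) (Suc k) =
     fps_nth (q_fact_fps q n) (Suc k) - q ^ n * fps_nth (q_fact_fps q n) k"
   "fps_nth (q_fact_fps q (Suc n)) 0 = fps_nth (q_fact_fps q n) 0" by simp_all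
qed

lemma q_fact_fps_nth_0 [simp]: "fps_nth (q_fact_fps q n) 0 = 1"
  by (induction n) (simp_all add: q_fact_fps_Suc_nth, simp add: q_fact_fps_def)

lemma q_fact_fps_nth_greater: "k > n \<Longrightarrow> fps_nth (q_fact_fps q n) k = 0"
proof (induction n arbitrary: k)
  case 0
  thus ?case by (simp add: q_fact_fps_def)
next
  case (Suc n)
  thus ?case by (cases k) (simp_all add: q_fact_fps_Suc_nth)
qed

lemma q_fact_fps_nth_same: "fps_nth (q_fact_fps q n) n = (\<Prod>i<n. - (q ^ i))"
  by (induction n) (simp_all add: q_fact_fps_Suc_nth q_fact_fps_nth_greater)

text \<open>The q-binomial theorem as a recurrence: the coefficient of x^k in (x;q)_n is (-1)^k
  q^(k(k-1)/2) times the q-binomial coefficient of n over k. The cross-multiplied form can later be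
  read modulo p.\<close>

lemma q_fact_fps_nth_rec:
  "fps_nth (q_fact_fps q n) (Suc k) * (q ^ Suc k - 1) =
     fps_nth (q_fact_fps q n) k * (q ^ k - q ^ n)"
proof (induction n arbitrary: k)
  case 0
  thus ?case by (cases k) (simp_all add: q_fact_fps_def)
next
  case (Suc n)
  show ?case
  proof (cases k)
    case 0
    thus ?thesis using Suc.IH[of 0] by (simp add: q_fact_fps_Suc_nth algebra_simps)
  next
    case (Suc j)
    \<comment> \<open>Instantiated with \<open>x\<close> = q^j, \<open>y\<close> = q^n and with
      \<open>a\<close>, \<open>b\<close>, \<open>c\<close> the coefficients of
      \<open>q_fact_fps q n\<close> at j + 2, j + 1, j.\<close>
    have alg: "(a - y * b) * (q * (q * x) - 1) = (b - y * c) * (q * x - q * y)"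
      if "a * (q * (q * x) - 1) = b * (q * x - y)" "b * (q * x - 1) = c * (x - y)" for a b c x y
    proof -
      have "(a - y * b) * (q * (q * x) - 1) =
          a * (q * (q * x) - 1) - y * b * (q * (q * x) - 1)"
        by (simp add: algebra_simps)
      also have "\<dots> = b * (q * x - q * y) - q * y * (b * (q * x - 1))"
        unfolding that(1) by (simp add: algebra_simps)
      also have "\<dots> = (b - y * c) * (q * x - q * y)"
        unfolding that(2) by (simp add: algebra_simps)
      finally show ?thesis .
    qed
    from Suc show ?thesis using Suc.IH[of "Suc j"] Suc.IH[of j]
      by (simp add: q_fact_fps_Suc_nth alg)
  qed
qed

text \<open>Iterates e(q x) = (1 - x) e(x), which on coefficients is (q;q)_(j+1) = (1 - q^(j+1))
  (q;q)_j. The hypothesis keeps all denominators nonzero.\<close>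

lemma q_exp_scale:
  fixes q :: "'a::field"
  assumes "\<And>k. k > 0 \<Longrightarrow> q ^ k \<noteq> 1"
  shows "fps_scale (q ^ n) (q_exp q) = q_fact_fps q n * q_exp q"
proof (induction n)
  case 0
  show ?case by (rule fps_ext) (simp add: q_fact_fps_def)
next
  case (Suc n)
  have one: "fps_scale q (q_exp q) = (1 - fps_X) * q_exp q"
  proof (rule fps_ext)
    fix k
    show "fps_nth (fps_scale q (q_exp q)) k = fps_nth ((1 - fps_X) * q_exp q) k"
    proof (cases k)
      case 0
      thus ?thesis by (simp add: q_exp_def algebra_simps)
    next
      case (Suc j)
      have "1 - q ^ Suc j \<noteq> 0" using assms[of "Suc j"] by simp
      moreover have "1 / qpoch q q j = (1 - q ^ Suc j) * (1 / qpoch q q (Suc j))"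
        using calculation by (simp add: qpoch_Suc)
      ultimately show ?thesis unfolding Suc
        by (simp add: q_exp_def left_diff_distrib diff_divide_distrib del: power_Suc)
    qed
  qed
  have "fps_scale (q ^ Suc n) (q_exp q) = fps_scale (q ^ n) (fps_scale q (q_exp q))"
    by (simp add: fps_scale_scale mult.commute)
  also have "\<dots> = fps_scale (q ^ n) (1 - fps_X) * (q_fact_fps q n * q_exp q)"
    by (simp only: one fps_scale_mult Suc.IH)
  also have "fps_scale (q ^ n) (1 - fps_X) = 1 - fps_const (q ^ n) * fps_X"
    by (rule fps_ext) (auto simp: algebra_simps fps_X_def)
  also have "\<dots> * (q_fact_fps q n * q_exp q) = q_fact_fps q (Suc n) * q_exp q"
    by (simp add: q_fact_fps_def ac_simps)
  finally show ?case .
qed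

section \<open>The damping series H\<close>

text \<open>Equal to Q^(j(j-1)/2) / (Q;Q)_j, Euler's coefficient of z^j in the product of 1 + z Q^i
  over i >= 0.\<close>

definition damp_coeff :: "'a::field \<Rightarrow> nat \<Rightarrow> 'a" where
  "damp_coeff Q j = (\<Prod>i<j. Q ^ i / (1 - Q ^ Suc i))"

(* Expansion of the product of 1 + s x^N q^(N^2 i) over all i (Euler's identity). *)
definition damp_fps :: "'a::field \<Rightarrow> nat \<Rightarrow> 'a \<Rightarrow> 'a fps" where
  "damp_fps q N s =
     Abs_fps (\<lambda>m. if N dvd m then damp_coeff (q ^ (N * N)) (m div N) * s ^ (m div N) else 0)"

text \<open>The dilation x -> q^N x turns x^N into q^(N^2) x^N, so it shifts the infinite product by
  one factor and 1 + s x^N splits off. On coefficients this is the relation between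
  \<open>damp_coeff\<close> at i and at i + 1.\<close>

lemma damp_fps_functional_equation:
  fixes q :: "'a::field"
  assumes q: "\<And>k. k > 0 \<Longrightarrow> q ^ k \<noteq> 1" and N: "N > 0"
  shows "damp_fps q N s = (1 + fps_const s * fps_X ^ N) * fps_scale (q ^ N) (damp_fps q N s)"
proof (rule fps_ext)
  fix m
  let ?H = "damp_fps q N s"
  define Q where "Q = q ^ (N * N)"
  have "fps_nth ((1 + fps_const s * fps_X ^ N) * fps_scale (q ^ N) ?H) m =
      fps_nth (fps_scale (q ^ N) ?H + fps_const s * (fps_X ^ N * fps_scale (q ^ N) ?H)) m"
    by (simp add: algebra_simps)
  also have "\<dots> = q ^ (N * m) * fps_nth ?H m +
      (if m < N then 0 else s * (q ^ (N * (m - N)) * fps_nth ?H (m - N)))"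
    by (simp add: fps_X_power_mult_nth power_mult)
  also have "\<dots> = fps_nth ?H m"
  proof (cases "N dvd m")
    case False
    hence "\<not> N dvd (m - N)" if "\<not> m < N"
      using that by (simp add: dvd_minus_self)
    thus ?thesis using False by (simp add: damp_fps_def)
  next
    case True
    then obtain j where j: "m = N * j" by blast
    show ?thesis
    proof (cases j)
      case 0
      thus ?thesis using j N by simp
    next
      case (Suc i)
      have m: "m - N = N * i" "\<not> m < N" using j Suc by simp_all
      have Qk: "q ^ (N * (N * k)) = Q ^ k" for k
        by (simp add: Q_def power_mult[symmetric] mult.assoc)
      have H: "fps_nth ?H (N * k) = damp_coeff Q k * s ^ k" for k
        using N by (simp add: damp_fps_def Q_def)
      have "1 - Q ^ Suc i \<noteq> 0"
        using q[of "N * N * Suc i"] N by (simp add: Q_def power_mult[symmetric] del: power_Suc)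
      hence "damp_coeff Q (Suc i) * (1 - Q ^ Suc i) = damp_coeff Q i * Q ^ i"
        by (simp add: damp_coeff_def)
      hence "Q ^ Suc i * damp_coeff Q (Suc i) + Q ^ i * damp_coeff Q i = damp_coeff Q (Suc i)"
        by (simp add: algebra_simps del: power_Suc)
      hence "Q ^ Suc i * (damp_coeff Q (Suc i) * s ^ Suc i) + s * (Q ^ i * (damp_coeff Q i * s ^ i)) =
          damp_coeff Q (Suc i) * s ^ Suc i"
        by (metis (no_types, lifting) distrib_right mult.assoc mult.left_commute power_Suc)
      thus ?thesis using m by (simp add: j Suc Qk H del: power_Suc mult_Suc_right)
    qed
  qed
  finally show "fps_nth ?H m = fps_nth ((1 + fps_const s * fps_X ^ N) * fps_scale (q ^ N) ?H) m" ..
qed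

section \<open>The even series with parameter t\<close>

text \<open>The even part of e(t^(1/2) x), written without a square root; t = q and t = -1 give the
  two generating functions F and G.\<close>

definition q_even_series :: "'a::field \<Rightarrow> 'a \<Rightarrow> 'a fps" where
  "q_even_series q t = Abs_fps (\<lambda>m. if even m then t ^ (m div 2) / qpoch q q m else 0)"

text \<open>Substituting t^(1/2) x for x in H with s = t^(-d) gives H with s = 1. As H has only
  exponents divisible by 2 d, multiplying by it respects even parts, where only whole powers of t
  occur.\<close>

lemma q_even_series_mult_damp:
  fixes q t :: "'a::field"
  assumes "t \<noteq> 0" and d: "d > 0"
  shows "fps_nth (q_even_series q t * damp_fps q (2 * d) 1) m =
    (if even m then t ^ (m div 2) *
       fps_nth (q_exp q * damp_fps q (2 * d) (inverse (t ^ d))) m else 0)"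
proof (cases "even m")
  case True
  then obtain n where n: "m = 2 * n" by blast
  have "fps_nth (q_even_series q t) i * fps_nth (damp_fps q (2 * d) 1) (m - i) =
      t ^ n * (fps_nth (q_exp q) i * fps_nth (damp_fps q (2 * d) (inverse (t ^ d))) (m - i))"
    if i: "i \<le> m" for i
  proof (cases "2 * d dvd m - i")
    case False
    thus ?thesis by (simp add: damp_fps_def)
  next
    case True
    then obtain j where j: "m - i = 2 * d * j" by blast
    hence i': "i = 2 * (n - d * j)" "n = (n - d * j) + d * j"
      using i n by (auto simp: algebra_simps)
    \<comment> \<open>The support of H forces i/2 = n - d j; the missing power t^(-d j) becomes the
      j-th power of s.\<close>
    have "t ^ n = t ^ (n - d * j) * (t ^ d) ^ j"
      by (subst i'(2)) (simp add: power_add power_mult)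
    hence "t ^ (n - d * j) = t ^ n * inverse (t ^ d) ^ j"
      using assms by (simp add: power_inverse field_simps)
    moreover have "even i" "i div 2 = n - d * j" using i' by simp_all
    ultimately show ?thesis
      using d by (simp add: j damp_fps_def q_even_series_def q_exp_def)
  qed
  hence "fps_nth (q_even_series q t * damp_fps q (2 * d) 1) m =
      t ^ n * fps_nth (q_exp q * damp_fps q (2 * d) (inverse (t ^ d))) m"
    by (simp add: fps_mult_nth sum_distrib_left)
  thus ?thesis using n by simp
next
  case False
  have "fps_nth (q_even_series q t) i * fps_nth (damp_fps q (2 * d) 1) (m - i) = 0"
    if i: "i \<le> m" for i
  proof (cases "even i")
    case True
    hence "odd (m - i)" using False i by simp
    hence "\<not> 2 * d dvd m - i" by (meson dvd_mult_left)
    thus ?thesis by (simp add: damp_fps_def)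
  qed (simp add: q_even_series_def)
  hence "fps_nth (q_even_series q t * damp_fps q (2 * d) 1) m = 0"
    unfolding fps_mult_nth by (intro sum.neutral) auto
  thus ?thesis using False by simp
qed

(* R plays the role of the local ring at a prime p modulo which q^d = -1 and q has order 2 d;
   "simple" says that p divides 1 - q^k at most once. *)
locale q_root_of_minus_one =
  fixes R :: "'a::field set" and p q :: 'a and d :: nat
  assumes R_1: "1 \<in> R"
    and R_minus: "x \<in> R \<Longrightarrow> - x \<in> R"
    and R_add: "x \<in> R \<Longrightarrow> y \<in> R \<Longrightarrow> x + y \<in> R"
    and R_mult: "x \<in> R \<Longrightarrow> y \<in> R \<Longrightarrow> x * y \<in> R"
    and q: "q \<in> R" "inverse q \<in> R" "q \<noteq> 0"
    and q_power: "k > 0 \<Longrightarrow> q ^ k \<noteq> 1"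
    and d: "d > 0"
    and q_root: "q ^ d + 1 \<in> (*) p ` R"
    and order: "0 < k \<Longrightarrow> k < 2 * d \<Longrightarrow> inverse (1 - q ^ k) \<in> R"
    and simple: "0 < k \<Longrightarrow> 2 * d dvd k \<Longrightarrow> p / (1 - q ^ k) \<in> R"
begin

section \<open>Calculus in R and modulo the ideal I = p R\<close>

abbreviation I :: "'a set" where "I \<equiv> (*) p ` R"

lemma R_0: "0 \<in> R"
  using R_add[OF R_1 R_minus[OF R_1]] by simp

lemma R_diff: "x \<in> R \<Longrightarrow> y \<in> R \<Longrightarrow> x - y \<in> R"
  using R_add[of x "- y"] R_minus by simp

lemma R_power: "x \<in> R \<Longrightarrow> x ^ n \<in> R"
  by (induction n) (auto intro: R_1 R_mult)

lemma R_sum: "(\<And>i. i \<in> A \<Longrightarrow> f i \<in> R) \<Longrightarrow> sum f A \<in> R"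
  by (induction A rule: infinite_finite_induct) (auto intro: R_0 R_add)

lemma I_0: "0 \<in> I"
  using R_0 by force

lemma I_minus: "x \<in> I \<Longrightarrow> - x \<in> I"
  by (auto intro!: image_eqI[of _ _ "- _"] R_minus)

lemma I_add: "x \<in> I \<Longrightarrow> y \<in> I \<Longrightarrow> x + y \<in> I"
  by (auto intro!: image_eqI[of _ _ "_ + _"] R_add simp: distrib_left)

lemma I_diff: "x \<in> I \<Longrightarrow> y \<in> I \<Longrightarrow> x - y \<in> I"
  using I_add[of x "- y"] I_minus by simp

lemma I_mult: "x \<in> I \<Longrightarrow> y \<in> R \<Longrightarrow> x * y \<in> I"
  by (auto intro!: image_eqI[of _ _ "_ * _"] R_mult simp: mult.assoc)

lemma I_mult': "y \<in> R \<Longrightarrow> x \<in> I \<Longrightarrow> y * x \<in> I"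
  using I_mult[of x y] by (simp add: mult.commute)

lemma I_sum: "(\<And>i. i \<in> A \<Longrightarrow> f i \<in> I) \<Longrightarrow> sum f A \<in> I"
  by (induction A rule: infinite_finite_induct) (auto intro: I_0 I_add)

lemma I_power_diff:
  assumes "x \<in> R" "y \<in> R" "x - y \<in> I"
  shows "x ^ n - y ^ n \<in> I"
proof (induction n)
  case (Suc n)
  have "x ^ Suc n - y ^ Suc n = x * (x ^ n - y ^ n) + (x - y) * y ^ n"
    by (simp add: algebra_simps)
  thus ?case
    using Suc assms by (simp only: I_add I_mult I_mult' R_power)
qed (simp add: I_0)

lemma q_root': "q ^ (2 * d * k) - 1 \<in> I"
proof -
  have "q ^ (2 * d) - 1 = (q ^ d + 1) * (q ^ d - 1)"
    by (simp add: algebra_simps flip: power_add) (simp add: mult_2_right)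
  hence "q ^ (2 * d) - 1 \<in> I"
    by (simp add: I_mult q_root R_diff R_power q R_1)
  from I_power_diff[OF _ R_1 this, of k] show ?thesis
    by (simp add: R_power q power_mult)
qed

text \<open>First half of (x;q)_(2d) = 1 - x^(2d) modulo p. The recurrence starts with the factor 1
  - q^(2d), which lies in I, and divides by 1 - q^k only for 0 < k < 2 d, where \<open>order\<close>
  makes this a unit of R.\<close>

lemma q_fact_fps_nth_I:
  assumes "0 < k" "k < 2 * d"
  shows "fps_nth (q_fact_fps q (2 * d)) k \<in> I"
  using assms
proof (induction k)
  case (Suc k)
  let ?f = "fps_nth (q_fact_fps q (2 * d))"
  have *: "?f k * (q ^ k - q ^ (2 * d)) \<in> I"
  proof (cases "k = 0")
    case True
    have "1 - q ^ (2 * d) \<in> I" using I_minus[OF q_root'[of 1]] by simp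
    thus ?thesis using True by simp
  next
    case False
    thus ?thesis using Suc by (simp add: I_mult R_diff R_power q)
  qed
  have "q ^ Suc k - 1 \<noteq> 0" using q_power[of "Suc k"] by simp
  hence "?f (Suc k) = ?f k * (q ^ k - q ^ (2 * d)) * - inverse (1 - q ^ Suc k)"
    using q_fact_fps_nth_rec[of q "2 * d" k] by (simp add: field_simps del: power_Suc)
  thus ?case
    using * order[of "Suc k"] Suc.prems by (simp only: I_mult R_minus)
qed simp

text \<open>The even number of signs cancels and leaves q^(d(2d-1)) = (q^d)^(2d-1), which is
  (-1)^(2d-1) = -1 modulo p.\<close>

lemma q_fact_fps_nth_top: "fps_nth (q_fact_fps q (2 * d)) (2 * d) + 1 \<in> I"
proof -
  obtain c where c: "d = Suc c" using d by (cases d) auto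
  have "(\<Prod>i<2 * n. - (q ^ i)) = q ^ (n * (2 * n - 1))" for n
  proof (induction n)
    case (Suc n)
    have "(\<Prod>i<2 * Suc n. - (q ^ i)) = q ^ (n * (2 * n - 1)) * (q ^ (2 * n) * q ^ (2 * n + 1))"
      unfolding Suc[symmetric] by (simp add: mult.assoc)
    also have "\<dots> = q ^ (Suc n * (2 * Suc n - 1))"
    proof -
      have "n * (2 * n - 1) + (2 * n + (2 * n + 1)) = Suc n * (2 * Suc n - 1)"
        by (cases n) (simp_all add: algebra_simps)
      thus ?thesis by (simp only: power_add[symmetric])
    qed
    finally show ?case .
  qed simp
  hence "fps_nth (q_fact_fps q (2 * d)) (2 * d) = (q ^ d) ^ (2 * d - 1)"
    by (simp only: q_fact_fps_nth_same power_mult)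
  moreover have "(- 1 :: 'a) ^ (2 * d - 1) = - 1"
    by (simp add: c)
  ultimately have "fps_nth (q_fact_fps q (2 * d)) (2 * d) + 1 =
      (q ^ d) ^ (2 * d - 1) - (- 1) ^ (2 * d - 1)"
    by simp
  also have "\<dots> \<in> I"
    using q_root by (intro I_power_diff) (simp_all add: R_power R_minus R_1 q)
  finally show ?thesis .
qed

section \<open>Integrality of e H and of F/G at p\<close>

text \<open>With N = 2 d and u = e H, the functional equation and the earlier coefficients put
  (q^(Nm) - 1) u_m into I. By \<open>simple\<close> the division by q^(Nm) - 1 costs at most one
  factor p, so u_m stays in R.\<close>

lemma q_exp_damp_regular:
  assumes s: "s \<in> R" "s + 1 \<in> I"
  shows "fps_nth (q_exp q * damp_fps q (2 * d) s) m \<in> R"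
proof (induction m rule: less_induct)
  case (less m)
  define N where "N = 2 * d"
  define u where "u = q_exp q * damp_fps q N s"
  define a where "a = 1 + fps_const s * fps_X ^ N"
  define r where "r = q_fact_fps q N - a"
  have N: "N > 0" using d by (simp add: N_def)
  \<comment> \<open>The dilation of e contributes (x;q)_N, while \<open>a\<close> times the dilated
    H is H again.\<close>
  have "a * fps_scale (q ^ N) u = q_fact_fps q N * q_exp q * (a * fps_scale (q ^ N) (damp_fps q N s))"
    by (simp add: u_def fps_scale_mult q_exp_scale q_power ac_simps)
  also have "\<dots> = q_fact_fps q N * u"
    unfolding a_def by (subst damp_fps_functional_equation[symmetric])
      (simp_all add: q_power N u_def ac_simps)
  finally have eq: "a * (fps_scale (q ^ N) u - u) = r * u"
    by (simp add: r_def algebra_simps)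
  \<comment> \<open>Every coefficient of \<open>r\<close> vanishes modulo p; at k = N this is where
    s = -1 modulo p enters.\<close>
  have r: "fps_nth r k \<in> I" for k
  proof -
    consider "k = 0" | "0 < k" "k < N" | "k = N" | "k > N" by linarith
    thus ?thesis
    proof cases
      case 3
      thus ?thesis
        using N I_diff[OF q_fact_fps_nth_top s(2)] by (simp add: r_def a_def N_def)
    next
      case 4
      thus ?thesis using N I_0 q_fact_fps_nth_greater[of N k q]
        by (simp add: r_def a_def)
    next
      case 2
      thus ?thesis using q_fact_fps_nth_I[of k] by (simp add: r_def a_def N_def)
    qed (use N I_0 in \<open>simp add: r_def a_def\<close>)
  qed
  have r0: "fps_nth r 0 = 0" using N by (simp add: r_def a_def)
  have IH: "fps_nth u k \<in> R" if "k < m" for k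
    using less that by (simp add: u_def N_def)
  show ?case
  proof (cases "m = 0")
    case True
    thus ?thesis by (simp add: q_exp_def damp_fps_def damp_coeff_def R_1)
  next
    case False
    \<comment> \<open>Since \<open>r\<close> has no constant term, only coefficients of
      \<open>u\<close> below m contribute.\<close>
    have ru: "fps_nth (r * u) m \<in> I"
      unfolding fps_mult_nth
    proof (rule I_sum)
      fix i assume "i \<in> {0..m}"
      show "fps_nth r i * fps_nth u (m - i) \<in> I"
        using False r r0 IH[of "m - i"] by (cases "i = 0") (simp_all add: I_0 I_mult)
    qed
    define v where "v = fps_scale (q ^ N) u - u"
    have v: "fps_nth v k = (q ^ (N * k) - 1) * fps_nth u k" for k
      by (simp add: v_def power_mult algebra_simps)
    have "a * v = v + fps_const s * (fps_X ^ N * v)"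
      by (simp add: a_def algebra_simps)
    hence "r * u = v + fps_const s * (fps_X ^ N * v)"
      using eq by (simp add: v_def)
    hence "fps_nth (r * u) m =
        fps_nth v m + (if m < N then 0 else s * fps_nth v (m - N))"
      by (simp add: fps_X_power_mult_nth)
    moreover have "(if m < N then 0 else s * fps_nth v (m - N)) \<in> I"
      using N IH[of "m - N"] q_root'[of "m - N"] False
      by (simp add: v I_0 I_mult I_mult' s(1) N_def)
    ultimately have "fps_nth v m \<in> I"
      using I_diff[OF ru] by (metis add_diff_cancel_right')
    then obtain y where y: "y \<in> R" "(q ^ (N * m) - 1) * fps_nth u m = p * y"
      unfolding v by blast
    have "q ^ (N * m) - 1 \<noteq> 0" using q_power[of "N * m"] N False by simp
    hence "fps_nth u m = p / (1 - q ^ (N * m)) * - y"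
      using y(2) by (simp add: field_simps)
    moreover have "p / (1 - q ^ (N * m)) \<in> R"
      using simple[of "N * m"] N False by (simp add: N_def)
    ultimately have "fps_nth u m \<in> R"
      using y(1) by (simp only: R_mult R_minus)
    thus ?thesis by (simp only: u_def N_def)
  qed
qed

lemma fps_mult_regular:
  "(\<And>m. fps_nth f m \<in> R) \<Longrightarrow> (\<And>m. fps_nth g m \<in> R) \<Longrightarrow> fps_nth (f * g) m \<in> R"
  by (auto simp: fps_mult_nth intro!: R_sum R_mult)

text \<open>With constant term 1 the recursion for the coefficients of the inverse involves no
  division.\<close>

lemma fps_inverse_regular:
  assumes f: "\<And>m. fps_nth f m \<in> R" and "fps_nth f 0 = 1"
  shows "fps_nth (inverse f) m \<in> R"
proof (induction m rule: less_induct)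
  case (less m)
  show ?case
  proof (cases "m = 0")
    case True
    thus ?thesis using assms by (simp add: R_1)
  next
    case False
    have "0 = fps_nth (f * inverse f) m"
      using assms(2) False inverse_mult_eq_1'[of f] by simp
    also have "\<dots> = fps_nth (inverse f) m + (\<Sum>i=1..m. fps_nth f i * fps_nth (inverse f) (m - i))"
      by (simp add: fps_mult_nth sum.atLeast_Suc_atMost assms(2))
    finally have "fps_nth (inverse f) m = - (\<Sum>i=1..m. fps_nth f i * fps_nth (inverse f) (m - i))"
      by (simp add: eq_neg_iff_add_eq_0)
    also have "\<dots> \<in> R"
      using less f by (intro R_minus R_sum R_mult) auto
    finally show ?thesis .
  qed
qed

text \<open>The same H, with s = 1, serves for both parameters and has constant term 1, so it
  cancels from the quotient.\<close>

theorem q_even_series_quotient_regular: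
  assumes t: "t \<in> R" "inverse t \<in> R" "t \<noteq> 0" "t ^ d + 1 \<in> I"
    and t': "t' \<in> R" "inverse t' \<in> R" "t' \<noteq> 0" "t' ^ d + 1 \<in> I"
  shows "fps_nth (q_even_series q t * inverse (q_even_series q t')) m \<in> R"
proof -
  define H where "H = damp_fps q (2 * d) 1"
  have H0: "fps_nth H 0 = 1" by (simp add: H_def damp_fps_def damp_coeff_def)
  have reg: "fps_nth (q_even_series q x * H) m \<in> R"
    if x: "x \<in> R" "inverse x \<in> R" "x \<noteq> 0" "x ^ d + 1 \<in> I" for x m
  proof -
    \<comment> \<open>With \<open>x\<close> as the parameter t, this makes s = t^(-d) equal to -1
      modulo p, as \<open>q_exp_damp_regular\<close> requires.\<close>
    have "inverse (x ^ d) + 1 = (x ^ d + 1) * inverse (x ^ d)"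
      using x by (simp add: algebra_simps)
    moreover have "inverse (x ^ d) \<in> R"
      using x by (simp add: power_inverse[symmetric] R_power)
    ultimately have "inverse (x ^ d) \<in> R" "inverse (x ^ d) + 1 \<in> I"
      using x by (simp_all add: I_mult)
    from q_exp_damp_regular[OF this] show ?thesis
      unfolding H_def by (subst q_even_series_mult_damp) (use x d in \<open>auto intro: R_mult R_power R_0\<close>)
  qed
  have G0: "fps_nth (q_even_series q t') 0 = 1" by (simp add: q_even_series_def)
  have "q_even_series q t * inverse (q_even_series q t') =
      (q_even_series q t * H) * inverse (q_even_series q t' * H)"
    using H0 inverse_mult_eq_1'[of H] by (simp add: fps_inverse_mult ac_simps)
  also have "fps_nth \<dots> m \<in> R"
    using G0 H0 by (intro fps_mult_regular fps_inverse_regular reg t t') simp_all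
  finally show ?thesis .
qed

end

section \<open>Prime divisors of 1 - q^m in Z[q]\<close>

abbreviation qX :: "int poly" where "qX \<equiv> monom 1 (Suc 0)"

lemma monom_eq_qX_power: "monom 1 k = qX ^ k"
  by (simp add: monom_power)

lemma to_fract_power: "to_fract (a ^ n) = to_fract a ^ n"
  by (induction n) simp_all

lemma to_fract_prod: "to_fract (\<Prod>i\<in>A. f i) = (\<Prod>i\<in>A. to_fract (f i))"
  by (induction A rule: infinite_finite_induct) simp_all

lemma lead_coeff_one_minus_qX_power:
  assumes "m > 0"
  shows "lead_coeff (1 - qX ^ m) = -1"
proof -
  have c: "coeff (1 - qX ^ m) m = -1"
    using assms by (simp add: monom_eq_qX_power[symmetric])
  have "degree (1 - qX ^ m) \<le> m"
    by (intro degree_diff_le) (simp_all add: monom_eq_qX_power[symmetric] degree_monom_le)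
  moreover have "m \<le> degree (1 - qX ^ m)"
    using c by (intro le_degree) simp
  ultimately show ?thesis using c by (metis le_antisym)
qed

lemma one_minus_qX_power_neq_0: "m > 0 \<Longrightarrow> 1 - qX ^ m \<noteq> 0"
  using lead_coeff_one_minus_qX_power[of m] by auto

text \<open>The leading coefficient of 1 - q^m is the unit -1, so a constant divisor is a unit. This
  excludes the integer primes.\<close>

lemma degree_pos_if_dvd_one_minus_qX_power:
  assumes "\<not> is_unit p" "m > 0" "p dvd 1 - qX ^ m"
  shows "degree p > 0"
proof (rule ccontr)
  assume "\<not> degree p > 0"
  then obtain c where c: "p = [:c:]" by (auto elim: degree_eq_zeroE)
  from assms(3) have "lead_coeff p dvd lead_coeff (1 - qX ^ m)"
    by (metis dvdE dvd_triv_left lead_coeff_mult)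
  hence "c dvd 1" using c lead_coeff_one_minus_qX_power[OF assms(2)] by simp
  thus False using assms(1) c by (simp add: is_unit_poly_iff)
qed

lemma qX_not_prime_dvd:
  assumes "\<not> is_unit p" "m > 0" "p dvd 1 - qX ^ m"
  shows "\<not> p dvd qX"
proof
  assume "p dvd qX"
  hence "p dvd qX ^ m" using assms(2) by (metis dvd_power dvd_trans)
  with assms(3) have "p dvd (1 - qX ^ m) + qX ^ m" by (rule dvd_add)
  thus False using assms(1) by simp
qed

text \<open>Separability: otherwise p would divide the derivative -m q^(m-1), but p does not divide
  q, and its positive degree keeps it from dividing the constant m.\<close>

lemma prime_square_not_dvd_one_minus_qX_power:
  assumes p: "prime_elem p" and m: "m > 0"
  shows "\<not> p * p dvd 1 - qX ^ m"
proof
  assume "p * p dvd 1 - qX ^ m"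
  then obtain c where c: "1 - qX ^ m = p * (p * c)" by (metis dvdE mult.assoc)
  have pd: "p dvd 1 - qX ^ m" using c by simp
  have nu: "\<not> is_unit p" using p by (simp add: prime_elem_def)
  have "pderiv (1 - qX ^ m) = p * pderiv (p * c) + (p * c) * pderiv p"
    unfolding c by (rule pderiv_mult)
  hence "p dvd pderiv (1 - qX ^ m)" by simp
  also have "pderiv (1 - qX ^ m) = - ([:int m:] * qX ^ (m - 1))"
    by (simp add: monom_eq_qX_power[symmetric] pderiv_diff pderiv_monom smult_monom)
  finally have "p dvd [:int m:] * qX ^ (m - 1)" by (simp only: dvd_minus_iff)
  moreover have "\<not> p dvd qX ^ (m - 1)"
    using qX_not_prime_dvd[OF nu m pd] p prime_elem_dvd_power by blast
  ultimately have "p dvd [:int m:]" using p prime_elem_dvd_mult_iff by blast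
  hence "degree p \<le> degree [:int m:]" using m by (intro dvd_imp_degree_le) simp_all
  thus False using degree_pos_if_dvd_one_minus_qX_power[OF nu m pd] by simp
qed

text \<open>Here 2 d is the order N of q modulo p. N divides 2 k but not k, so k odd makes N = 2 d
  with d odd, and p must divide the second factor of (1 - q^d)(1 + q^d). Up to sign p is the
  cyclotomic polynomial of index 2 d.\<close>

lemma prime_dvd_one_plus_qX_power_odd:
  assumes p: "prime_elem p" and k: "odd k" and dvd: "p dvd 1 + qX ^ k"
  obtains d where "odd d" "p dvd 1 + qX ^ d" "\<And>m. p dvd 1 - qX ^ m \<longleftrightarrow> 2 * d dvd m"
proof -
  have nu: "\<not> is_unit p" using p by (simp add: prime_elem_def)
  have k0: "k > 0" using k by (auto elim: oddE)
  have factor: "1 - qX ^ (2 * j) = (1 - qX ^ j) * (1 + qX ^ j)" for j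
    by (simp add: algebra_simps flip: power_add) (simp add: mult_2_right)
  have dvd2: "p dvd 1 - qX ^ (2 * k)"
    unfolding factor using dvd by simp
  have npow: "\<not> p dvd qX ^ a" for a
    using qX_not_prime_dvd[OF nu _ dvd2] k0 p prime_elem_dvd_power by auto
  define N where "N = (LEAST N. N > 0 \<and> p dvd 1 - qX ^ N)"
  have N: "N > 0" "p dvd 1 - qX ^ N"
    using LeastI[of "\<lambda>N. N > 0 \<and> p dvd 1 - qX ^ N" "2 * k"] dvd2 k0 by (auto simp: N_def)
  have least: "N \<le> m" if "m > 0" "p dvd 1 - qX ^ m" for m
    unfolding N_def using that by (intro Least_le) simp
  \<comment> \<open>Exponents are reduced by N as in the Euclidean algorithm; p does not divide
    q^N.\<close>
  have ord: "p dvd 1 - qX ^ m \<longleftrightarrow> N dvd m" for m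
  proof (induction m rule: less_induct)
    case (less m)
    show ?case
    proof (cases "m < N")
      case True
      thus ?thesis using least[of m] by (cases "m = 0") (auto dest: dvd_imp_le)
    next
      case False
      have "1 - qX ^ m = (1 - qX ^ N) + qX ^ N * (1 - qX ^ (m - N))"
        using False by (simp add: algebra_simps power_add[symmetric])
      hence "p dvd 1 - qX ^ m \<longleftrightarrow> p dvd qX ^ N * (1 - qX ^ (m - N))"
        using N(2) by (simp only: dvd_add_right_iff)
      also have "\<dots> \<longleftrightarrow> p dvd 1 - qX ^ (m - N)"
        using npow p by (simp add: prime_elem_dvd_mult_iff)
      also have "\<dots> \<longleftrightarrow> N dvd m - N" using less N(1) False by simp
      finally show ?thesis using False by (simp add: dvd_minus_self)
    qed
  qed
  have "\<not> N dvd k"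
  proof
    assume "N dvd k"
    hence "p dvd 1 - qX ^ k" by (simp only: ord)
    \<comment> \<open>The sum is the constant 2, which p cannot divide because its degree is
      positive.\<close>
    from this dvd have "p dvd (1 - qX ^ k) + (1 + qX ^ k)" by (rule dvd_add)
    hence "p dvd [:2:]" by (simp add: numeral_poly)
    hence "degree p \<le> degree [:2 :: int:]" by (intro dvd_imp_degree_le) simp_all
    thus False using degree_pos_if_dvd_one_minus_qX_power[OF nu _ dvd2] k0 by simp
  qed
  moreover have N2: "N dvd 2 * k" using dvd2 ord by blast
  ultimately have "even N"
    by (metis coprime_commute coprime_dvd_mult_right_iff coprime_left_2_iff_odd)
  then obtain d where d: "N = 2 * d" by blast
  have "d dvd k" using N2 d by simp
  hence "odd d" using k by (meson dvd_trans)
  moreover have "p dvd 1 + qX ^ d"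
  proof -
    have "\<not> p dvd 1 - qX ^ d" using ord[of d] d N(1) by (auto dest: dvd_imp_le)
    thus ?thesis using N(2) p unfolding d factor by (simp add: prime_elem_dvd_mult_iff)
  qed
  ultimately show ?thesis using that ord d by blast
qed

section \<open>Localization at a prime, inside the field of fractions\<close>

definition regular_fracts :: "'a::idom \<Rightarrow> 'a fract set" where
  "regular_fracts p = {to_fract a / to_fract b | a b. \<not> p dvd b}"

lemma regular_fractsI: "\<not> p dvd b \<Longrightarrow> to_fract a / to_fract b \<in> regular_fracts p"
  by (auto simp: regular_fracts_def)

lemma to_fract_regular: "\<not> is_unit p \<Longrightarrow> to_fract a \<in> regular_fracts p"
  using regular_fractsI[of p 1 a] by simp

lemma regular_fracts_subring:
  assumes p: "prime_elem p" and xy: "x \<in> regular_fracts p" "y \<in> regular_fracts p"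
  shows "x + y \<in> regular_fracts p" "x * y \<in> regular_fracts p" "- x \<in> regular_fracts p"
proof -
  from xy obtain a b c e where
    x: "x = to_fract a / to_fract b" "\<not> p dvd b" and y: "y = to_fract c / to_fract e" "\<not> p dvd e"
    by (auto simp: regular_fracts_def)
  have be: "\<not> p dvd b * e" using p x y by (simp add: prime_elem_dvd_mult_iff)
  have "b \<noteq> 0" "e \<noteq> 0" using x y by auto
  hence "x + y = to_fract (a * e + c * b) / to_fract (b * e)" "x * y = to_fract (a * c) / to_fract (b * e)"
    using x y by (simp_all add: field_simps)
  thus "x + y \<in> regular_fracts p" "x * y \<in> regular_fracts p"
    by (simp_all only: regular_fractsI[OF be])
  have "- x = to_fract (- a) / to_fract b" using x by simp
  thus "- x \<in> regular_fracts p" using regular_fractsI[OF x(2)] by metis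
qed

lemma q_Salie_quotient_regular:
  assumes p: "prime_elem p" and k: "odd k" "p dvd 1 + qX ^ k"
  shows "q_Salie (2 * n) / qpoch qf qf (2 * n) \<in> regular_fracts p"
proof -
  obtain d where odd_d: "odd d" and dvd_d: "p dvd 1 + qX ^ d"
    and ord: "\<And>m. p dvd 1 - qX ^ m \<longleftrightarrow> 2 * d dvd m"
    using prime_dvd_one_plus_qX_power_odd[OF p k] by metis
  have nu: "\<not> is_unit p" using p by (simp add: prime_elem_def)
  have d0: "d > 0" using odd_d by (auto elim: oddE)
  have nX: "\<not> p dvd qX" using qX_not_prime_dvd[OF nu, of "2 * d"] d0 ord by simp
  have qfk: "qf ^ m = to_fract (qX ^ m)" for m
    by (simp add: qf_def to_fract_power)
  have one_minus: "1 - qf ^ m = to_fract (1 - qX ^ m)" for m by (simp add: qfk)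
  have root: "qf ^ d + 1 \<in> (*) (to_fract p) ` regular_fracts p"
  proof -
    from dvd_d obtain c where "1 + qX ^ d = p * c" by blast
    hence "to_fract (1 + qX ^ d) = to_fract p * to_fract c" by (simp only: to_fract_mult)
    hence "qf ^ d + 1 = to_fract p * to_fract c" by (simp add: qfk add.commute)
    thus ?thesis using to_fract_regular[OF nu] by blast
  qed
  interpret q_root_of_minus_one "regular_fracts p" "to_fract p" qf d
  proof
    show "1 \<in> regular_fracts p" using to_fract_regular[OF nu, of 1] by simp
    show "qf \<in> regular_fracts p"
      by (simp add: to_fract_regular nu qf_def)
    show "inverse qf \<in> regular_fracts p"
      using regular_fractsI[OF nX, of 1] by (simp add: qf_def field_simps)
    show "qf \<noteq> 0" by (simp add: qf_def)
    show "qf ^ m \<noteq> 1" if "m > 0" for m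
      using one_minus[of m] one_minus_qX_power_neq_0[OF that] by (metis diff_self to_fract_eq_0_iff)
    show "inverse (1 - qf ^ m) \<in> regular_fracts p" if "0 < m" "m < 2 * d" for m
    proof -
      have "\<not> p dvd 1 - qX ^ m" using ord that by (auto dest: dvd_imp_le)
      from regular_fractsI[OF this, of 1] show ?thesis by (simp add: one_minus field_simps del: to_fract_diff)
    qed
    show "to_fract p / (1 - qf ^ m) \<in> regular_fracts p" if "0 < m" "2 * d dvd m" for m
    proof -
      \<comment> \<open>As 1 - q^m has no square prime factor, p does not divide the cofactor
        \<open>c\<close>, and p / (1 - q^m) = 1 / c is p-integral.\<close>
      from that ord obtain c where c: "1 - qX ^ m = p * c" by blast
      have "\<not> p dvd c" using prime_square_not_dvd_one_minus_qX_power[OF p that(1)] c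
        by (metis mult_dvd_mono dvd_refl)
      moreover have "p \<noteq> 0" using p by (simp add: prime_elem_def)
      hence "to_fract p / (1 - qf ^ m) = to_fract 1 / to_fract c"
        unfolding one_minus c by simp
      ultimately show ?thesis using regular_fractsI by metis
    qed
  qed (use regular_fracts_subring[OF p] d0 root in blast)+
  have "even_qseries (\<lambda>n. t ^ n) = q_even_series qf t" for t
    by (simp add: even_qseries_def q_even_series_def)
  hence "q_Salie (2 * n) / qpoch qf qf (2 * n) =
      fps_nth (q_even_series qf qf * inverse (q_even_series qf (-1))) (2 * n)"
    by (simp add: q_Salie_def qpoch_qf_nonzero)
  \<comment> \<open>For t = q the condition on t^d is \<open>q_root\<close>; for t = -1 it is (-1)^d
    + 1 = 0, as d is odd.\<close>
  also have "\<dots> \<in> regular_fracts p"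
    using q q_root odd_d by (intro q_even_series_quotient_regular)
      (simp_all add: R_1 R_minus I_0 power_minus_odd)
  finally show ?thesis .
qed

section \<open>Polynomiality of S_(2n)(q)\<close>

lemma to_fract_range:
  "x \<in> range to_fract \<Longrightarrow> y \<in> range to_fract \<Longrightarrow> x + y \<in> range to_fract"
  "x \<in> range to_fract \<Longrightarrow> y \<in> range to_fract \<Longrightarrow> x - y \<in> range to_fract"
  "x \<in> range to_fract \<Longrightarrow> y \<in> range to_fract \<Longrightarrow> x * y \<in> range to_fract"
  "x \<in> range to_fract \<Longrightarrow> x ^ n \<in> range to_fract"
  by (auto simp flip: to_fract_add to_fract_diff to_fract_mult to_fract_power)

lemma to_fract_range_0: "0 \<in> range to_fract"
  using to_fract_0 by (metis rangeI)

lemma to_fract_range_sum: "(\<And>i. i \<in> A \<Longrightarrow> f i \<in> range to_fract) \<Longrightarrow> sum f A \<in> range to_fract"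
  by (induction A rule: infinite_finite_induct)
    (simp_all add: to_fract_range(1) to_fract_range_0)

text \<open>The q-Pascal rule, from 1 - q^(m+k) = (1 - q^m) + q^m (1 - q^k).\<close>

lemma q_binomial_polynomial:
  "qpoch qf qf (m + k) / (qpoch qf qf m * qpoch qf qf k) \<in> range to_fract"
proof (induction "m + k" arbitrary: m k rule: less_induct)
  case less
  let ?B = "\<lambda>m k. qpoch qf qf (m + k) / (qpoch qf qf m * qpoch qf qf k)"
  show ?case
  proof (cases "m = 0 \<or> k = 0")
    case True
    hence "?B m k = to_fract 1" by (auto simp: qpoch_qf_nonzero)
    thus ?thesis by (metis rangeI)
  next
    case False
    then obtain i j where ij: "m = Suc i" "k = Suc j" by (meson not0_implies_Suc)
    have nz: "1 - qf * qf ^ l \<noteq> 0" for l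
      using qpoch_qf_nonzero[of "Suc l"] by (simp add: qpoch_Suc)
    have nz': "qpoch qf qf l \<noteq> 0" for l by (rule qpoch_qf_nonzero)
    define U where "U = qpoch qf qf (Suc (i + j))"
    have "?B m k = U * (1 - qf * qf ^ Suc (i + j)) /
        (qpoch qf qf i * (1 - qf * qf ^ i) * (qpoch qf qf j * (1 - qf * qf ^ j)))"
      unfolding ij by (simp add: qpoch_Suc U_def)
    also have "1 - qf * qf ^ Suc (i + j) = (1 - qf * qf ^ i) + qf ^ m * (1 - qf * qf ^ j)"
      by (simp add: ij algebra_simps power_add)
    also have "U * \<dots> / (qpoch qf qf i * (1 - qf * qf ^ i) * (qpoch qf qf j * (1 - qf * qf ^ j))) =
       ?B i k + qf ^ m * ?B m j"
      using nz nz' by (simp add: ij qpoch_Suc U_def[symmetric] divide_simps)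
        (simp add: U_def qpoch_Suc algebra_simps)
    also have "\<dots> \<in> range to_fract"
      using less[of i k] less[of m j] ij
      by (intro to_fract_range) (auto simp: qf_def)
    finally show ?thesis .
  qed
qed

text \<open>Comparing coefficients in F = S G gives S_(2n) = q^n minus the sum over j < n of
  (-1)^(n-j) S_(2j) times the q-binomial coefficient of 2n over 2j.\<close>

lemma q_Salie_polynomial: "q_Salie (2 * n) \<in> range to_fract"
proof (induction n rule: less_induct)
  case (less n)
  let ?qp = "qpoch qf qf"
  let ?S = "even_qseries (\<lambda>n. q_Salie (2 * n))" and ?G = "even_qseries (\<lambda>n. (-1) ^ n)"
  have "fps_nth ?G 0 \<noteq> 0" by (simp add: even_qseries_nth)
  hence "?S * ?G = even_qseries (\<lambda>n. qf ^ n)"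
    unfolding q_Salie_gf by (simp add: mult.assoc inverse_mult_eq_1)
  hence "qf ^ n / ?qp (2 * n) = fps_nth (?S * ?G) (2 * n)"
    by (simp add: even_qseries_nth)
  also have "\<dots> = q_Salie (2 * n) / ?qp (2 * n) +
      (\<Sum>i<2*n. fps_nth ?S i * fps_nth ?G (2 * n - i))"
    by (simp add: fps_mult_nth even_qseries_nth atLeast0AtMost lessThan_Suc_atMost[symmetric])
  finally have "q_Salie (2 * n) = qf ^ n -
      (\<Sum>i<2*n. ?qp (2 * n) * (fps_nth ?S i * fps_nth ?G (2 * n - i)))"
    using qpoch_qf_nonzero[of "2 * n"] by (simp add: field_simps flip: sum_distrib_left)
  also have "\<dots> \<in> range to_fract"
  proof (rule to_fract_range(2)[OF to_fract_range(4) to_fract_range_sum])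
    show "qf \<in> range to_fract" by (simp add: qf_def)
    fix i assume i: "i \<in> {..<2 * n}"
    show "?qp (2 * n) * (fps_nth ?S i * fps_nth ?G (2 * n - i)) \<in> range to_fract"
    proof (cases "even i")
      case True
      then obtain j where j: "i = 2 * j" by blast
      define l where "l = n - j"
      have l: "n = j + l" "2 * n = i + 2 * l" using i j by (simp_all add: l_def)
      have "?qp (2 * n) * (fps_nth ?S i * fps_nth ?G (2 * n - i)) =
          q_Salie (2 * j) * (to_fract (-1) ^ l * (?qp (i + 2 * l) / (?qp i * ?qp (2 * l))))"
        unfolding l(2) by (simp add: even_qseries_nth j)
      thus ?thesis
        by (simp only: simp_thms) (intro to_fract_range less q_binomial_polynomial rangeI, use i j in auto)
    next
      case False
      thus ?thesis by (simp add: even_qseries_nth to_fract_range_0)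
    qed
  qed
  finally show ?case .
qed

section \<open>Products dividing (q;q)_(2n)\<close>

lemma one_minus_dvd_one_minus_power: "1 - y dvd 1 - y ^ j" for y :: "'a::comm_ring_1"
proof (induction j)
  case (Suc j)
  have "1 - y ^ Suc j = (1 - y) + y * (1 - y ^ j)" by (simp add: algebra_simps)
  thus ?case using Suc by (metis dvd_add dvd_mult dvd_refl)
qed simp

lemma one_plus_qX_power_dvd: "1 + qX ^ k dvd 1 - qX ^ (2 * k * j)"
proof -
  have "1 - (qX ^ k) ^ 2 = (1 + qX ^ k) * (1 - qX ^ k)"
    by (simp add: algebra_simps power2_eq_square)
  hence "1 + qX ^ k dvd 1 - (qX ^ k) ^ 2" by simp
  also have "\<dots> dvd 1 - ((qX ^ k) ^ 2) ^ j" by (rule one_minus_dvd_one_minus_power)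
  finally show ?thesis by (simp add: mult.commute mult.left_commute flip: power_mult)
qed

text \<open>The factors on the left are those of (q;q)_(2n) with exponents 2c, 4c, ..., 2cm <= 2n.
  Used with c = 1 for P_n and with c = 2r + 1 for the powers of 1 + q^(2r+1).\<close>

lemma prod_one_minus_qX_power_dvd:
  assumes "c > 0" "c * m \<le> n"
  shows "(\<Prod>j=1..m. 1 - qX ^ (2 * c * j)) dvd (\<Prod>i<2*n. 1 - qX ^ Suc i)"
proof -
  \<comment> \<open>The factor of index i has exponent i + 1, hence the shift by 1.\<close>
  define f where "f j = 2 * c * j - 1" for j
  have f: "Suc (f j) = 2 * c * j" if "j \<in> {1..m}" for j
    using that assms(1) by (simp add: f_def)
  have "inj_on f {1..m}"
    using assms(1) by (intro inj_onI) (metis f mult_cancel1 mult_is_0 neq0_conv zero_neq_numeral)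
  hence "(\<Prod>j=1..m. 1 - qX ^ (2 * c * j)) = (\<Prod>i\<in>f ` {1..m}. 1 - qX ^ Suc i)"
    by (subst prod.reindex) (auto intro!: prod.cong simp: f simp del: power_Suc)
  also have "\<dots> dvd (\<Prod>i<2*n. 1 - qX ^ Suc i)"
  proof (rule prod_dvd_prod_subset)
    have "f j < 2 * n" if j: "j \<in> {1..m}" for j
    proof -
      have "c * j \<le> n" using j assms(2) by (meson atLeastAtMost_iff le_trans mult_le_mono2)
      thus ?thesis using f[OF j] by simp
    qed
    thus "f ` {1..m} \<subseteq> {..<2 * n}" by auto
  qed simp
  finally show ?thesis .
qed

lemma p_factor_odd:
  assumes "k > 0"
  obtains y where "odd y" "p_factor k = 1 + qX ^ y" "y dvd k"
proof -
  define e where "e = multiplicity 2 k"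
  have "k \<noteq> 0" "\<not> is_unit (2 :: nat)" using assms by simp_all
  then obtain y where y: "k = 2 ^ e * y" "odd y"
    unfolding e_def by (rule multiplicity_decompose')
  have "k div 2 ^ e = y" by (subst y(1)) simp
  hence "p_factor k = 1 + qX ^ y"
    by (simp only: p_factor_def monom_eq_qX_power[of y] e_def)
  moreover have "y dvd k" by (subst y(1)) simp
  ultimately show ?thesis using that y(2) by blast
qed

theorem theorem1p3:
  fixes n :: nat
  assumes "n \<ge> 1"
  shows "\<exists>S :: int poly. to_fract S = q_Salie (2 * n) \<and>
           P_poly n dvd S \<and>
           (\<forall>r :: nat. (1 + monom 1 (2 * r + 1)) ^ (n div (2 * r + 1)) dvd S)"
proof -
  obtain S where S: "to_fract S = q_Salie (2 * n)" using q_Salie_polynomial[of n] by force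
  define Q where "Q = (\<Prod>i<2*n. 1 - qX ^ Suc i)"
  have Q: "to_fract Q = qpoch qf qf (2 * n)"
    by (simp add: Q_def qpoch_def to_fract_prod to_fract_power qf_def)
  define c where "c = q_Salie (2 * n) / qpoch qf qf (2 * n)"
  define a b where "a = fst (quot_of_fract c)" and "b = snd (quot_of_fract c)"
  have b0: "b \<noteq> 0" by (simp add: b_def)
  have ab: "coprime a b" by (simp add: a_def b_def coprime_quot_of_fract)
  have c: "c = to_fract a / to_fract b"
    by (simp add: a_def b_def flip: Fract_conv_to_fract)
  have "to_fract (S * b) = to_fract (a * Q)"
    using c b0 qpoch_qf_nonzero[of "2 * n"] by (simp add: S Q c_def field_simps)
  hence SQ: "S * b = a * Q" by (simp only: to_fract_eq_iff)
  \<comment> \<open>Since \<open>c\<close> is p-integral, a prime p dividing both 1 + q^k and the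
    reduced denominator \<open>b\<close> would also divide \<open>a\<close>.\<close>
  have cop: "coprime (1 + qX ^ k) b" if k: "odd k" for k
  proof (rule ccontr)
    assume "\<not> coprime (1 + qX ^ k) b"
    then obtain p where p: "prime p" "p dvd 1 + qX ^ k" "p dvd b"
      using prime_divisor_exists[of "gcd (1 + qX ^ k) b"] b0 by auto
    have "c \<in> regular_fracts p"
      using q_Salie_quotient_regular[OF _ k p(2)] p(1) by (simp add: c_def)
    then obtain a' b' where c': "c = to_fract a' / to_fract b'" "\<not> p dvd b'"
      by (auto simp: regular_fracts_def)
    have "b' \<noteq> 0" using c'(2) by auto
    hence "to_fract (a * b') = to_fract (a' * b)" using c c' b0 by (simp add: field_simps)
    hence "a * b' = a' * b" by (simp only: to_fract_eq_iff)
    hence "p dvd a * b'" using p(3) by simp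
    hence "p dvd a" using p(1) c'(2) by (simp add: prime_dvd_mult_iff)
    thus False using ab p(1,3) by (meson coprime_common_divisor not_prime_unit)
  qed
  \<comment> \<open>In S b = a Q, a divisor of Q = (q;q)_(2n) coprime to \<open>b\<close> must
    divide S.\<close>
  have dvd_S: "D dvd S" if "D dvd Q" "coprime D b" for D
  proof -
    have "D dvd S * b" unfolding SQ using that(1) by simp
    thus ?thesis using that(2) by (simp add: coprime_dvd_mult_left_iff)
  qed
  have "P_poly n dvd S"
  proof (rule dvd_S)
    \<comment> \<open>The k-th factor 1 + q^y is matched with 1 - q^(2k): the odd part y of k
      divides k.\<close>
    have "P_poly n dvd (\<Prod>k=1..n. 1 - qX ^ (2 * 1 * k))"
      unfolding P_poly_def
    proof (rule prod_dvd_prod)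
      fix k assume "k \<in> {1..n}"
      then obtain y where "p_factor k = 1 + qX ^ y" "y dvd k"
        using p_factor_odd[of k] by auto
      thus "p_factor k dvd 1 - qX ^ (2 * 1 * k)"
        using one_plus_qX_power_dvd[of y] by (auto simp: mult.assoc)
    qed
    also have "\<dots> dvd Q"
      unfolding Q_def by (rule prod_one_minus_qX_power_dvd) simp_all
    finally show "P_poly n dvd Q" .
    show "coprime (P_poly n) b"
      unfolding P_poly_def
    proof (rule prod_coprime_left)
      fix k assume "k \<in> {1..n}"
      thus "coprime (p_factor k) b"
        using p_factor_odd[of k] cop by (metis atLeastAtMost_iff less_eq_Suc_le One_nat_def)
    qed
  qed
  moreover have "(1 + monom 1 (2 * r + 1)) ^ (n div (2 * r + 1)) dvd S" for r
  proof (rule dvd_S)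
    define k where "k = 2 * r + 1"
    have "(1 + qX ^ k) ^ (n div k) = (\<Prod>j=1..n div k. 1 + qX ^ k)" by simp
    \<comment> \<open>The equal factors are matched with different factors 1 - q^(2kj) of Q.\<close>
    also have "\<dots> dvd (\<Prod>j=1..n div k. 1 - qX ^ (2 * k * j))"
      by (intro prod_dvd_prod one_plus_qX_power_dvd)
    also have "\<dots> dvd Q"
      unfolding Q_def by (rule prod_one_minus_qX_power_dvd) (simp_all add: k_def del: mult_Suc)
    finally show "(1 + monom 1 (2 * r + 1)) ^ (n div (2 * r + 1)) dvd Q"
      unfolding k_def monom_eq_qX_power[of "2 * r + 1"] .
    show "coprime ((1 + monom 1 (2 * r + 1)) ^ (n div (2 * r + 1))) b"
      unfolding monom_eq_qX_power[of "2 * r + 1"] using cop[of "2 * r + 1"] by simp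
  qed
  ultimately show ?thesis using S by blast
qed

end
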